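(* Let $f:\mathbb{R}^n\to\mathbb{R}$ be locally Lipschitz with a strict first-order model $\phi$, let $x\in\mathbb{R}^n$ be a serious iterate and $Q$ a symmetric matrix. Consider the inner loop of the non-smooth trust-region algorithm at $x$ (described in the context), with trust-region radii $R_k$. Suppose the inner loop at $x$ turns infinitely and the trust-region radius $R_k$ stays bounded away from $0$. Let $Q\succ0$ and suppose the aggregation rule is used to taper out the working models in Step 6. Suppose the solutions $y^k$ of the tangent programs are chosen as trial steps, i.e. $z^k=y^k$ for all $k$. Then $x$ is a critical point of the program $\min_{y\in\mathbb{R}^n}f(y)$, i.e. $0\in\partial f(x)$.
   Context: $\partial f$ denotes the Clarke subdifferential; $\partial_1\phi(y,x)$ is the convex subdifferential of $\phi(\cdot,x)$ at $y$. A critical point of $\min f$ is a point $x$ with $0\in\partial f(x)$. Strict first-order model: a function $\phi:\mathbb{R}^n\times\mathbb{R}^n\to\mathbb{R}$ such that ($M_1$) $\phi(\cdot,x)$ is convex, $\phi(x,x)=f(x)$, and $\partial_1\phi(x,x)\subset\partial f(x)$ for every $x$; ($\widehat M_2$) if $x_k\to x$ and $y_k\to x$, then there exist $\epsilon_k\to0^+$ with $f(y_k)\le\phi(y_k,x_k)+\epsilon_k\|y_k-x_k\|$; ($M_3$) if $x_k\to x$, $y_k\to y$, then $\limsup_{k\to\infty}\phi(y_k,x_k)\le\phi(y,x)$. Cutting planes: for a trial step $z$ and a subgradient $g\in\partial_1\phi(z,x)$, the affine function $m_z(\cdot,x)=\phi(z,x)+g^\top(\cdot-z)$ is a cutting plane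 at serious iterate $x$ and trial step $z$. If $z=x$ it is called an exactness plane. Inner loop at $x$. Constants: $0<\gamma<\widetilde\gamma<1$, $0<\theta\ll1$, $\theta<1$, $M\ge1$; a fixed norm $\|\cdot\|$ on $\mathbb{R}^n$ (trust-region norm); initial radius $R_1>0$. At each counter $k\ge1$ there is a first-order working model $\phi_k(\cdot,x)$, which is a maximum of finitely many affine minorants of $\phi(\cdot,x)$ (so $\phi_k(\cdot,x)\le\phi(\cdot,x)$), always including at least one exactness plane at $x$; the second-order working model is $\Phi_k(\cdot,x)=\phi_k(\cdot,x)+\frac12(\cdot-x)^\top Q(\cdot-x)$. At counter $k$: (Step 4) $y^k$ is a solution of the tangent program: minimize $\Phi_k(y,x)$ subject to $\|y-x\|\le R_k$. The trial step $z^k$ is any point with $\|z^k-x\|\le M\|y^k-x\|$ and $f(x)-\Phi_k(z^k,x)\ge\theta\,(f(x)-\Phi_k(y^k,x))$ (the choice $z^k=y^k$ is always allowed). (Step 5) If $\rho_k=\dfrac{f(x)-f(z^k)}{f(x)-\Phi_k(z^k,x)}\ge\gamma$, then $z^k$ is accepted as the new serious iterate and the inner loop ends. Otherwise (null step) continue. (Step 6) A cutting plane at $x$ and $z^k$ is included in the new working model $\phi_{k+1}(\cdot,x)$; older planes may be removed, provided an exactness plane at $x$ remains. (Step 7) With $\widetilde\rho_k=\dfrac{f(x)-\phi_{k+1}(z^k,x)}{f(x)-\Phi_k(z^k,x)}$, put $R_{k+1}=R_k$ if $\widetilde\rho_k<\widetilde\gamma$ and $R_{k+1}=\frac12R_k$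 if $\widetilde\rho_k\ge\widetilde\gamma$. Increase $k$ and return to Step 4. "The inner loop turns infinitely" means that no trial step is ever accepted: $\rho_k<\gamma$ for every $k\ge1$. Aggregation: by the optimality condition for the tangent program there is $g_k^*\in\partial_1\phi_k(y^k,x)$ (the aggregate subgradient; $\partial_1$ here is the convex subdifferential of $\phi_k(\cdot,x)$) with $g_k^*+Q(y^k-x)+v_k=0$, where $v_k$ lies in the normal cone to the ball $B(x,R_k)=\{y:\|y-x\|\le R_k\}$ at $y^k$. The aggregate plane is $m_k^*(\cdot,x)=\phi_k(y^k,x)+g_k^{*\top}(\cdot-y^k)$. The aggregation rule: in Step 6 the new working model $\phi_{k+1}(\cdot,x)$ contains at least an exactness plane at $x$, the latest cutting plane (at the last unsuccessful trial step), and the aggregate plane $m_k^*(\cdot,x)$; all other planes may be removed. *)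

theory Defs
  imports "HOL-Analysis.Analysis"
begin

section \<open>Subdifferentials\<close>

definition locally_lipschitz :: "('a::metric_space \<Rightarrow> 'b::metric_space) \<Rightarrow> bool" where
  "locally_lipschitz f \<longleftrightarrow> (\<forall>x. \<exists>e>0. \<exists>L. lipschitz_on L (ball x e) f)"

text \<open>Extended-real valued, so that the upper limit is meaningful for every \<open>f\<close>.\<close>

definition clarke_derivative :: "('a::real_inner \<Rightarrow> real) \<Rightarrow> 'a \<Rightarrow> 'a \<Rightarrow> ereal" where
  "clarke_derivative f x v =
     Limsup (nhds x \<times>\<^sub>F at_right 0) (\<lambda>(y, t). ereal ((f (y + t *\<^sub>R v) - f y) / t))"

definition clarke_subdiff :: "('a::real_inner \<Rightarrow> real) \<Rightarrow> 'a \<Rightarrow> 'a set" where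
  "clarke_subdiff f x = {g. \<forall>v. ereal (g \<bullet> v) \<le> clarke_derivative f x v}"

definition critical_point :: "('a::real_inner \<Rightarrow> real) \<Rightarrow> 'a \<Rightarrow> bool" where
  "critical_point f x \<longleftrightarrow> 0 \<in> clarke_subdiff f x"

definition convex_subdiff :: "('a::real_inner \<Rightarrow> real) \<Rightarrow> 'a \<Rightarrow> 'a set" where
  "convex_subdiff h y = {g. \<forall>w. h y + g \<bullet> (w - y) \<le> h w}"

definition normal_cone :: "'a::real_inner set \<Rightarrow> 'a \<Rightarrow> 'a set" where
  "normal_cone C y = {v. y \<in> C \<and> (\<forall>w\<in>C. v \<bullet> (w - y) \<le> 0)}"


section \<open>Strict first-order models\<close>

text \<open>A model \<open>\<phi>(y, x)\<close> is written \<open>\<phi> y x\<close>: the second argument is the reference point.\<close>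

definition strict_first_order_model ::
  "('a::real_inner \<Rightarrow> real) \<Rightarrow> ('a \<Rightarrow> 'a \<Rightarrow> real) \<Rightarrow> bool" where
  "strict_first_order_model f \<phi> \<longleftrightarrow>
     (\<forall>x. convex_on UNIV (\<lambda>y. \<phi> y x) \<and> \<phi> x x = f x \<and>
          convex_subdiff (\<lambda>y. \<phi> y x) x \<subseteq> clarke_subdiff f x) \<and>
     (\<forall>x xs ys. xs \<longlonglongrightarrow> x \<and> ys \<longlonglongrightarrow> x \<longrightarrow>
        (\<exists>\<epsilon>::nat \<Rightarrow> real. (\<forall>k. 0 < \<epsilon> k) \<and> \<epsilon> \<longlonglongrightarrow> 0 \<and>
           (\<forall>k. f (ys k) \<le> \<phi> (ys k) (xs k) + \<epsilon> k * norm (ys k - xs k)))) \<and>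
     (\<forall>x y xs ys. xs \<longlonglongrightarrow> x \<and> ys \<longlonglongrightarrow> y \<longrightarrow>
        limsup (\<lambda>k. ereal (\<phi> (ys k) (xs k))) \<le> ereal (\<phi> y x))"


section \<open>Planes and working models\<close>

definition affine_minorant :: "('a::real_inner \<Rightarrow> real) \<Rightarrow> ('a \<Rightarrow> real) \<Rightarrow> bool" where
  "affine_minorant h p \<longleftrightarrow> (\<exists>g c. p = (\<lambda>y. c + g \<bullet> y)) \<and> (\<forall>y. p y \<le> h y)"

definition cutting_plane ::
  "('a::real_inner \<Rightarrow> 'a \<Rightarrow> real) \<Rightarrow> 'a \<Rightarrow> 'a \<Rightarrow> ('a \<Rightarrow> real) \<Rightarrow> bool" where
  "cutting_plane \<phi> x z p \<longleftrightarrow>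
     (\<exists>g \<in> convex_subdiff (\<lambda>y. \<phi> y x) z. p = (\<lambda>y. \<phi> z x + g \<bullet> (y - z)))"

definition exactness_plane ::
  "('a::real_inner \<Rightarrow> 'a \<Rightarrow> real) \<Rightarrow> 'a \<Rightarrow> ('a \<Rightarrow> real) \<Rightarrow> bool" where
  "exactness_plane \<phi> x p \<longleftrightarrow> cutting_plane \<phi> x x p"

text \<open>A first-order working model is represented by the finite set \<open>P\<close> of its planes;
  \<open>max_planes P\<close> is the working model as a function.\<close>

definition max_planes :: "('a \<Rightarrow> real) set \<Rightarrow> 'a \<Rightarrow> real" where
  "max_planes P y = Max ((\<lambda>p. p y) ` P)"

definition working_planes ::
  "('a::real_inner \<Rightarrow> 'a \<Rightarrow> real) \<Rightarrow> 'a \<Rightarrow> ('a \<Rightarrow> real) set \<Rightarrow> bool" where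
  "working_planes \<phi> x P \<longleftrightarrow>
     finite P \<and> (\<forall>p\<in>P. affine_minorant (\<lambda>y. \<phi> y x) p) \<and> (\<exists>p\<in>P. exactness_plane \<phi> x p)"

definition second_order_working ::
  "real^'n^'n \<Rightarrow> real^'n \<Rightarrow> (real^'n \<Rightarrow> real) set \<Rightarrow> real^'n \<Rightarrow> real" where
  "second_order_working Q x P y = max_planes P y + 1/2 * ((y - x) \<bullet> (Q *v (y - x)))"


section \<open>The inner loop\<close>

text \<open>The trust-region norm need not be the Euclidean one.\<close>

definition norm_function :: "('a::real_vector \<Rightarrow> real) \<Rightarrow> bool" where
  "norm_function N \<longleftrightarrow>
     (\<forall>v. 0 \<le> N v) \<and> (\<forall>v. N v = 0 \<longleftrightarrow> v = 0) \<and>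
     (\<forall>c v. N (c *\<^sub>R v) = \<bar>c\<bar> * N v) \<and> (\<forall>v w. N (v + w) \<le> N v + N w)"

definition trust_region :: "('a::real_vector \<Rightarrow> real) \<Rightarrow> 'a \<Rightarrow> real \<Rightarrow> 'a set" where
  "trust_region N x r = {y. N (y - x) \<le> r}"

text \<open>\<open>P\<close> are the planes of the working model at the current counter, \<open>P'\<close> those at the next one.
  A ratio whose denominator vanishes has the value 0, so such a step counts as a null step.\<close>

definition acceptance_ratio ::
  "(real^'n \<Rightarrow> real) \<Rightarrow> real^'n^'n \<Rightarrow> real^'n \<Rightarrow> (real^'n \<Rightarrow> real) set \<Rightarrow> real^'n \<Rightarrow> real" where
  "acceptance_ratio f Q x P z = (f x - f z) / (f x - second_order_working Q x P z)"

definition secondary_ratio ::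
  "(real^'n \<Rightarrow> real) \<Rightarrow> real^'n^'n \<Rightarrow> real^'n \<Rightarrow> (real^'n \<Rightarrow> real) set \<Rightarrow> (real^'n \<Rightarrow> real) set
     \<Rightarrow> real^'n \<Rightarrow> real" where
  "secondary_ratio f Q x P P' z = (f x - max_planes P' z) / (f x - second_order_working Q x P z)"

text \<open>Infinite sequences \<open>P\<close>, \<open>R\<close>, \<open>y\<close>, \<open>z\<close> (the counter starts at 1) in which every step
  is a null step. The parameters \<open>\<gamma>\<close> and \<open>\<gamma>'\<close> are the thresholds for acceptance and for
  halving the trust-region radius.\<close>

definition inner_loop_infinite ::
  "(real^'n \<Rightarrow> real) \<Rightarrow> (real^'n \<Rightarrow> real^'n \<Rightarrow> real) \<Rightarrow> real^'n^'n \<Rightarrow> (real^'n \<Rightarrow> real)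
     \<Rightarrow> real \<Rightarrow> real \<Rightarrow> real \<Rightarrow> real \<Rightarrow> real^'n
     \<Rightarrow> (nat \<Rightarrow> (real^'n \<Rightarrow> real) set) \<Rightarrow> (nat \<Rightarrow> real)
     \<Rightarrow> (nat \<Rightarrow> real^'n) \<Rightarrow> (nat \<Rightarrow> real^'n) \<Rightarrow> bool" where
  "inner_loop_infinite f \<phi> Q N \<gamma> \<gamma>' \<theta> M x P R y z \<longleftrightarrow>
     R 1 > 0 \<and>
     (\<forall>k\<ge>1.
        working_planes \<phi> x (P k) \<and>
        is_arg_min (second_order_working Q x (P k)) (\<lambda>w. w \<in> trust_region N x (R k)) (y k) \<and>
        N (z k - x) \<le> M * N (y k - x) \<and>
        f x - second_order_working Q x (P k) (z k)
          \<ge> \<theta> * (f x - second_order_working Q x (P k) (y k)) \<and>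
        acceptance_ratio f Q x (P k) (z k) < \<gamma> \<and>
        (\<exists>p\<in>P (Suc k). cutting_plane \<phi> x (z k) p) \<and>
        R (Suc k) = (if secondary_ratio f Q x (P k) (P (Suc k)) (z k) < \<gamma>'
                     then R k else R k / 2))"


section \<open>Aggregation\<close>

definition aggregate_subgradient ::
  "real^'n^'n \<Rightarrow> (real^'n \<Rightarrow> real) \<Rightarrow> real^'n \<Rightarrow> (real^'n \<Rightarrow> real) set \<Rightarrow> real \<Rightarrow> real^'n
     \<Rightarrow> real^'n \<Rightarrow> bool" where
  "aggregate_subgradient Q N x P r y g \<longleftrightarrow>
     g \<in> convex_subdiff (max_planes P) y \<and>
     (\<exists>v \<in> normal_cone (trust_region N x r) y. g + Q *v (y - x) + v = 0)"

definition aggregate_plane ::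
  "('a::real_inner \<Rightarrow> real) set \<Rightarrow> 'a \<Rightarrow> 'a \<Rightarrow> 'a \<Rightarrow> real" where
  "aggregate_plane P y g = (\<lambda>w. max_planes P y + g \<bullet> (w - y))"

definition aggregation_rule ::
  "(real^'n \<Rightarrow> real^'n \<Rightarrow> real) \<Rightarrow> real^'n^'n \<Rightarrow> (real^'n \<Rightarrow> real) \<Rightarrow> real^'n
     \<Rightarrow> (nat \<Rightarrow> (real^'n \<Rightarrow> real) set) \<Rightarrow> (nat \<Rightarrow> real)
     \<Rightarrow> (nat \<Rightarrow> real^'n) \<Rightarrow> (nat \<Rightarrow> real^'n) \<Rightarrow> bool" where
  "aggregation_rule \<phi> Q N x P R y z \<longleftrightarrow>
     (\<forall>k\<ge>1.
        (\<exists>p\<in>P (Suc k). exactness_plane \<phi> x p) \<and>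
        (\<exists>p\<in>P (Suc k). cutting_plane \<phi> x (z k) p) \<and>
        (\<exists>g. aggregate_subgradient Q N x (P k) (R k) (y k) g \<and>
             aggregate_plane (P k) (y k) g \<in> P (Suc k)))"

end

theory Submission
  imports Defs
begin

text \<open>Write \<open>h = \<phi>(\<cdot>, x)\<close> and let \<open>a\<^sub>k\<close> be the optimal value of the \<open>k\<close>-th tangent program.
  It suffices to show \<open>a\<^sub>k \<longlonglongrightarrow> f x\<close>. Indeed, \<open>a\<^sub>k\<close> is a lower bound of
  \<open>h + 1/2 (\<cdot> - x)\<^sup>T Q (\<cdot> - x)\<close> on the \<open>k\<close>-th trust region. These regions share a ball around \<open>x\<close>,
  on which, in the limit, \<open>x\<close> minimizes this function. The quadratic term is of second
  order at \<open>x\<close>, hence by convexity \<open>x\<close> minimizes \<open>h\<close>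
  (\<open>zero_subgradient_if_local_min_plus_quadratic\<close>), and \<open>0\<close> lies in the convex subdifferential
  of \<open>h\<close> at \<open>x\<close>, a part of the Clarke subdifferential of \<open>f\<close>.

  Aggregation makes \<open>a\<^sub>k\<close> converge. The aggregate plane remembers the optimality condition at
  \<open>y\<^sup>k\<close>, so that the next model grows quadratically away from \<open>y\<^sup>k\<close> on the trust region
  (\<open>aggregate_quadratic_growth\<close>). This gives
  \<open>a\<^sub>k + 1/2 |y\<^sup>k\<^sup>+\<^sup>1 - y\<^sup>k|\<^sub>Q\<^sup>2 \<le> a\<^sub>k\<^sub>+\<^sub>1 \<le> f x\<close>; the values \<open>a\<^sub>k\<close> increase to a limit and the
  steps \<open>y\<^sup>k\<^sup>+\<^sup>1 - y\<^sup>k\<close> tend to \<open>0\<close>. (Here \<open>|v|\<^sub>Q\<^sup>2 = v\<^sup>T Q v\<close>.)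

  The cutting planes identify the limit. As the iterates stay bounded, so do the subgradients of
  \<open>h\<close> at them (\<open>convex_subdiff_bounded\<close>). The plane cut at \<open>y\<^sup>k\<close> is therefore nearly exact at
  the nearby point \<open>y\<^sup>k\<^sup>+\<^sup>1\<close>, and the model error \<open>e\<^sub>k = h(y\<^sup>k) - \<phi>\<^sub>k(y\<^sup>k)\<close> tends to \<open>0\<close>. A radius
  bounded away from \<open>0\<close> is halved only finitely often, so eventually the secondary ratio is below
  \<open>\<gamma>'\<close>, which implies \<open>(1 - \<gamma>') (f x - a\<^sub>k) \<le> e\<^sub>k\<close>. Hence \<open>a\<^sub>k \<longlonglongrightarrow> f x\<close>.\<close>

section \<open>Quadratic forms\<close>

lemma posdef_quadratic_lower_bound:
  fixes Q :: "real^'n^'n"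
  assumes pos: "\<forall>v. v \<noteq> 0 \<longrightarrow> 0 < v \<bullet> (Q *v v)"
  obtains q where "0 < q" "\<And>v. q * (norm v)\<^sup>2 \<le> v \<bullet> (Q *v v)"
proof -
  let ?S = "sphere (0::real^'n) 1"
  have "continuous_on ?S (\<lambda>v. v \<bullet> (Q *v v))"
    by (intro continuous_intros linear_continuous_on_compose matrix_vector_mul_linear)
  moreover have "?S \<noteq> {}" "compact ?S"
    by auto
  ultimately obtain u where u: "u \<in> ?S" "\<And>v. v \<in> ?S \<Longrightarrow> u \<bullet> (Q *v u) \<le> v \<bullet> (Q *v v)"
    using continuous_attains_inf[of ?S "\<lambda>v. v \<bullet> (Q *v v)"] by blast
  define q where "q = u \<bullet> (Q *v u)"
  have "q * (norm v)\<^sup>2 \<le> v \<bullet> (Q *v v)" for v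
  proof (cases "v = 0")
    case False
    define s where "s = inverse (norm v) *\<^sub>R v"
    have "s \<in> ?S" and v: "v = norm v *\<^sub>R s"
      using False by (auto simp: s_def)
    have "v \<bullet> (Q *v v) = (norm v)\<^sup>2 * (s \<bullet> (Q *v s))"
      by (subst (1 2) v) (simp add: matrix_vector_mult_scaleR power2_eq_square)
    then show ?thesis
      using u(2)[OF \<open>s \<in> ?S\<close>] by (simp add: q_def mult.commute mult_right_mono)
  qed simp
  moreover have "0 < q"
    using u(1) pos unfolding q_def by (metis norm_zero mem_sphere_0 zero_neq_one)
  ultimately show thesis
    using that by blast
qed

lemma symmetric_quadratic_expansion:
  fixes Q :: "real^'n^'n"
  assumes "transpose Q = Q"
  shows "(w - x) \<bullet> (Q *v (w - x))
    = (y - x) \<bullet> (Q *v (y - x)) + 2 * ((Q *v (y - x)) \<bullet> (w - y)) + (w - y) \<bullet> (Q *v (w - y))"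
proof -
  define a b where "a = y - x" and "b = w - y"
  have "w - x = a + b"
    by (simp add: a_def b_def)
  moreover have "a \<bullet> (Q *v b) = (Q *v a) \<bullet> b"
    using dot_lmul_matrix[of a Q b] assms by (metis transpose_matrix_vector)
  ultimately show ?thesis
    by (simp add: a_def[symmetric] b_def[symmetric] matrix_vector_right_distrib
        inner_add_left inner_add_right inner_commute)
qed


section \<open>Convex subgradients\<close>

text \<open>A subgradient \<open>g\<close> at \<open>y\<close> forces \<open>h\<close> to rise by at least \<open>norm g\<close> over a unit step in the direction
  of \<open>g\<close>, and \<open>h\<close> is bounded on a slightly larger ball because it is continuous.\<close>

lemma convex_subdiff_bounded:
  fixes h :: "'a::euclidean_space \<Rightarrow> real"
  assumes "convex_on UNIV h"
  obtains L where "0 < L"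
    "\<And>y g. y \<in> cball x r \<Longrightarrow> g \<in> convex_subdiff h y \<Longrightarrow> norm g \<le> L"
proof -
  have "continuous_on (cball x (r + 1)) h"
    using convex_on_continuous[OF open_UNIV assms] continuous_on_subset by blast
  then have "bounded (h ` cball x (r + 1))"
    using compact_continuous_image compact_imp_bounded compact_cball by blast
  then obtain B where B: "0 < B" "\<And>y. y \<in> cball x (r + 1) \<Longrightarrow> \<bar>h y\<bar> \<le> B"
    unfolding bounded_pos by auto
  have "norm g \<le> 2 * B" if y: "y \<in> cball x r" and g: "g \<in> convex_subdiff h y" for y g
  proof (cases "g = 0")
    case False
    define u where "u = sgn g"
    have u: "norm u = 1" "g \<bullet> u = norm g"
      using False by (simp_all add: u_def norm_sgn sgn_div_norm dot_square_norm power2_eq_square)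
    have "h y + g \<bullet> (y + u - y) \<le> h (y + u)"
      using g unfolding convex_subdiff_def by blast
    then have "norm g \<le> h (y + u) - h y"
      using u(2) by simp
    moreover have "dist x (y + u) \<le> dist x y + 1"
      using dist_triangle[of x "y + u" y] u(1) by (simp add: dist_norm)
    then have "\<bar>h (y + u)\<bar> \<le> B" "\<bar>h y\<bar> \<le> B"
      using y by (auto intro!: B(2))
    ultimately show ?thesis
      by linarith
  qed (use B in simp)
  then show thesis
    using that[of "2 * B"] B(1) by simp
qed

text \<open>Over the fraction \<open>t\<close> of a segment from \<open>x\<close>, convexity lets \<open>h\<close> rise by at most \<open>t\<close> times its
  change over the whole segment, while the hypothesis lets it fall by at most a multiple of
  \<open>t\<^sup>2\<close>. Dividing by \<open>t\<close> and letting \<open>t\<close> tend to \<open>0\<close> shows that the change is nonnegative.\<close>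

lemma zero_subgradient_if_local_min_plus_quadratic:
  fixes h :: "real^'n \<Rightarrow> real" and Q :: "real^'n^'n"
  assumes h: "convex_on UNIV h" and N: "norm_function N" and r: "0 < r"
    and min: "\<And>w. w \<in> trust_region N x r \<Longrightarrow> h x \<le> h w + 1/2 * ((w - x) \<bullet> (Q *v (w - x)))"
  shows "0 \<in> convex_subdiff h x"
proof -
  have "h x \<le> h w" for w
  proof -
    define d where "d = w - x"
    define c where "c = d \<bullet> (Q *v d)"
    have step: "h x \<le> h w + t * (c / 2)" if t: "0 < t" "t \<le> 1" "t * N d \<le> r" for t
    proof -
      have "N (t *\<^sub>R d) = t * N d"
        using N t by (simp add: norm_function_def)
      then have "h x \<le> h (x + t *\<^sub>R d) + 1/2 * (t * t * c)"
        using min[of "x + t *\<^sub>R d"] t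
        by (simp add: trust_region_def c_def matrix_vector_mult_scaleR mult.assoc)
      moreover have "x + t *\<^sub>R d = (1 - t) *\<^sub>R x + t *\<^sub>R w"
        by (simp add: d_def algebra_simps)
      then have "h (x + t *\<^sub>R d) \<le> (1 - t) * h x + t * h w"
        using convex_onD[OF h, of t x w] t by simp
      ultimately have "t * h x \<le> t * (h w + t * (c / 2))"
        by (simp add: algebra_simps)
      then show ?thesis
        using t by simp
    qed
    have "((\<lambda>t. t * N d) \<longlongrightarrow> 0 * N d) (at_right 0)"
      by (intro tendsto_intros)
    then have "\<forall>\<^sub>F t in at_right 0. t * N d < r"
      using r by (simp add: order_tendsto_iff)
    moreover have "\<forall>\<^sub>F t in at_right (0::real). 0 < t \<and> t < 1"
      using eventually_at_right_real[of 0 1] by simp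
    ultimately have "\<forall>\<^sub>F t in at_right 0. h x \<le> h w + t * (c / 2)"
      by eventually_elim (use step in auto)
    moreover have "((\<lambda>t. h w + t * (c / 2)) \<longlongrightarrow> h w + 0 * (c / 2)) (at_right 0)"
      by (intro tendsto_intros)
    ultimately show ?thesis
      using tendsto_lowerbound[of _ "h w + 0 * (c / 2)"] by fastforce
  qed
  then show ?thesis
    by (simp add: convex_subdiff_def)
qed


section \<open>Working models\<close>

lemma plane_le_max_planes:
  assumes "finite P" "p \<in> P"
  shows "p w \<le> max_planes P w"
  using assms unfolding max_planes_def by (intro Max_ge) auto

lemma max_planes_le_model:
  assumes "working_planes \<phi> x P"
  shows "max_planes P w \<le> \<phi> w x"
proof -
  have "finite P" "P \<noteq> {}" "\<And>p. p \<in> P \<Longrightarrow> p w \<le> \<phi> w x"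
    using assms unfolding working_planes_def affine_minorant_def by auto
  then show ?thesis
    by (simp add: max_planes_def)
qed

lemma cutting_plane_exact:
  assumes "working_planes \<phi> x P" "p \<in> P" "cutting_plane \<phi> x z p"
  shows "max_planes P z = \<phi> z x"
proof (rule antisym)
  show "max_planes P z \<le> \<phi> z x"
    by (rule max_planes_le_model[OF assms(1)])
  have "p z = \<phi> z x"
    using assms(3) by (auto simp: cutting_plane_def)
  then show "\<phi> z x \<le> max_planes P z"
    using plane_le_max_planes[of P p z] assms by (simp add: working_planes_def)
qed

lemma max_planes_exact_at_reference:
  assumes "working_planes \<phi> x P"
  shows "max_planes P x = \<phi> x x"
proof -
  obtain p where "p \<in> P" "cutting_plane \<phi> x x p"
    using assms unfolding working_planes_def exactness_plane_def by blast
  then show ?thesis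
    by (rule cutting_plane_exact[OF assms])
qed

text \<open>The optimality condition bounds the slope at \<open>y\<close> of the aggregate plane plus the quadratic
  term from below by \<open>0\<close> on the trust region, which leaves the second-order part of the quadratic.
  This applies to any model containing the aggregate plane and to the model it stems from.\<close>

lemma aggregate_quadratic_growth:
  fixes Q :: "real^'n^'n"
  assumes Q: "transpose Q = Q" and g: "aggregate_subgradient Q N x P r y g"
    and w: "w \<in> trust_region N x r" and le: "aggregate_plane P y g w \<le> max_planes P' w"
  shows "second_order_working Q x P y + 1/2 * ((w - y) \<bullet> (Q *v (w - y)))
    \<le> second_order_working Q x P' w"
proof -
  obtain v where v: "v \<in> normal_cone (trust_region N x r) y" "g + Q *v (y - x) + v = 0"
    using g unfolding aggregate_subgradient_def by blast
  have "0 = (g + Q *v (y - x) + v) \<bullet> (w - y)"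
    using v(2) by simp
  also have "\<dots> = g \<bullet> (w - y) + (Q *v (y - x)) \<bullet> (w - y) + v \<bullet> (w - y)"
    by (simp add: inner_add_left)
  also have "v \<bullet> (w - y) \<le> 0"
    using v(1) w unfolding normal_cone_def by blast
  finally have "0 \<le> g \<bullet> (w - y) + (Q *v (y - x)) \<bullet> (w - y)"
    by simp
  then show ?thesis
    using le symmetric_quadratic_expansion[OF Q, of w x y]
    unfolding second_order_working_def aggregate_plane_def by linarith
qed

text \<open>Here \<open>u\<close> is the previous iterate and \<open>w\<close> the current one. One factor \<open>L\<close> pays for the descent
  of the cutting plane from \<open>u\<close> to \<open>w\<close>, the other for the growth of \<open>\<phi>(\<cdot>, x)\<close>, which the
  subgradient at \<open>w\<close> controls.\<close>

lemma model_error_le_step: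
  fixes \<phi> :: "'a::real_inner \<Rightarrow> 'a \<Rightarrow> real"
  assumes P: "working_planes \<phi> x P"
    and p: "p \<in> P" "cutting_plane \<phi> x u p"
    and g: "g \<in> convex_subdiff (\<lambda>y. \<phi> y x) w"
    and L: "\<And>y g. y \<in> {u, w} \<Longrightarrow> g \<in> convex_subdiff (\<lambda>y. \<phi> y x) y \<Longrightarrow> norm g \<le> L"
  shows "\<phi> w x - max_planes P w \<le> 2 * L * norm (w - u)"
proof -
  have bound: "\<bar>s \<bullet> (w - u)\<bar> \<le> L * norm (w - u)" if "norm s \<le> L" for s
    using that Cauchy_Schwarz_ineq2[of s "w - u"]
    by (meson mult_right_mono norm_ge_zero order_trans)
  obtain s where s: "s \<in> convex_subdiff (\<lambda>y. \<phi> y x) u" "p = (\<lambda>y. \<phi> u x + s \<bullet> (y - u))"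
    using p(2) unfolding cutting_plane_def by blast
  have "\<phi> u x + s \<bullet> (w - u) \<le> max_planes P w"
    using plane_le_max_planes[of P p w] P p(1) s(2) by (simp add: working_planes_def)
  moreover have "\<phi> w x + g \<bullet> (u - w) \<le> \<phi> u x"
    using g unfolding convex_subdiff_def by blast
  moreover have "g \<bullet> (u - w) = - (g \<bullet> (w - u))"
    by (simp add: inner_diff_right)
  moreover have "\<bar>s \<bullet> (w - u)\<bar> \<le> L * norm (w - u)" "\<bar>g \<bullet> (w - u)\<bar> \<le> L * norm (w - u)"
    using bound L s(1) g by blast+
  ultimately show ?thesis
    by linarith
qed


section \<open>Convergence of the inner loop\<close>

text \<open>A decreasing sequence bounded below has vanishing decrements, whereas each halving is a
  decrement of at least \<open>r / 2\<close>.\<close>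

lemma finitely_many_halvings:
  fixes R :: "nat \<Rightarrow> real"
  assumes R: "\<And>k. R (Suc k) = (if C k then R k else R k / 2)"
    and r: "0 < r" "\<And>k. r \<le> R k"
  shows "\<forall>\<^sub>F k in sequentially. C k"
proof -
  have "R (Suc k) \<le> R k" for k
    using R[of k] r(1) r(2)[of k] by simp
  then have "decseq R"
    by (rule decseq_SucI)
  then obtain l where l: "R \<longlonglongrightarrow> l"
    using decseq_convergent[of R r] r(2) by blast
  then have "(\<lambda>k. R k - R (Suc k)) \<longlonglongrightarrow> l - l"
    by (intro tendsto_diff LIMSEQ_Suc)
  then have "\<forall>\<^sub>F k in sequentially. R k - R (Suc k) < r / 2"
    by (rule order_tendstoD(2)) (use r in simp)
  then show ?thesis
  proof eventually_elim
    case (elim k)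
    then show ?case
      using R[of k] r(2)[of k] by (auto split: if_splits)
  qed
qed

lemma steps_vanish_if_sufficient_increase:
  fixes a :: "nat \<Rightarrow> real" and y :: "nat \<Rightarrow> 'a::real_normed_vector"
  assumes c: "0 < c" and inc: "\<And>k. a k + c * (norm (y (Suc k) - y k))\<^sup>2 \<le> a (Suc k)"
    and bd: "\<And>k. a k \<le> b"
  shows "(\<lambda>k. norm (y (Suc k) - y k)) \<longlonglongrightarrow> 0"
proof -
  have "a k \<le> a (Suc k)" for k
    using c by (intro order_trans[OF _ inc]) simp
  then have "incseq a"
    by (rule incseq_SucI)
  then obtain l where l: "a \<longlonglongrightarrow> l"
    using incseq_convergent bd by blast
  then have "(\<lambda>k. (a (Suc k) - a k) / c) \<longlonglongrightarrow> (l - l) / c"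
    using c by (intro tendsto_intros LIMSEQ_Suc) auto
  then have lim: "(\<lambda>k. (a (Suc k) - a k) / c) \<longlonglongrightarrow> 0"
    by simp
  have "(norm (y (Suc k) - y k))\<^sup>2 \<le> (a (Suc k) - a k) / c" for k
    using inc[of k] c by (simp add: field_simps)
  then have "(\<lambda>k. (norm (y (Suc k) - y k))\<^sup>2) \<longlonglongrightarrow> 0"
    by (intro Lim_null_comparison[OF always_eventually lim]) simp
  then show ?thesis
    by simp
qed

text \<open>Clearing the denominator is also sound when the model predicts no decrease: the ratio is then
  \<open>0\<close> by convention, and the claim reduces to the model being a minorant.\<close>

lemma optimal_value_gap_le_model_error:
  assumes ratio: "secondary_ratio f Q x P P' w < \<gamma>'"
    and exact: "max_planes P' w = \<phi> w x"
    and gap: "second_order_working Q x P w \<le> f x"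
    and minorant: "max_planes P w \<le> \<phi> w x"
    and psd: "0 \<le> (w - x) \<bullet> (Q *v (w - x))"
  shows "(1 - \<gamma>') * (f x - second_order_working Q x P w) \<le> \<phi> w x - max_planes P w"
proof -
  define D where "D = f x - second_order_working Q x P w"
  show ?thesis
  proof (cases "D = 0")
    case True
    then show ?thesis
      using minorant by (simp add: D_def)
  next
    case False
    then have "0 < D"
      using gap by (simp add: D_def)
    then have "f x - \<phi> w x \<le> \<gamma>' * D"
      using ratio exact by (simp add: secondary_ratio_def D_def[symmetric] divide_less_eq)
    moreover have "D \<le> f x - max_planes P w"
      using psd by (simp add: D_def second_order_working_def)
    ultimately show ?thesis
      by (simp add: D_def[symmetric] algebra_simps)
  qed
qed

theorem lemma3:
  fixes f :: "real^'n \<Rightarrow> real"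
    and \<phi> :: "real^'n \<Rightarrow> real^'n \<Rightarrow> real"
    and Q :: "real^'n^'n"
    and N :: "real^'n \<Rightarrow> real"
    and \<gamma> \<gamma>' \<theta> M :: real
    and x :: "real^'n"
    and P :: "nat \<Rightarrow> (real^'n \<Rightarrow> real) set"
    and R :: "nat \<Rightarrow> real"
    and y z :: "nat \<Rightarrow> real^'n"
  assumes "locally_lipschitz f"
    and "strict_first_order_model f \<phi>"
    and "norm_function N"
    and "0 < \<gamma>" "\<gamma> < \<gamma>'" "\<gamma>' < 1"
    and "0 < \<theta>" "\<theta> < 1"
    and "1 \<le> M"
    and "transpose Q = Q"
    and "\<forall>v. v \<noteq> 0 \<longrightarrow> 0 < v \<bullet> (Q *v v)"
    and "inner_loop_infinite f \<phi> Q N \<gamma> \<gamma>' \<theta> M x P R y z"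
    and "\<exists>r>0. \<forall>k\<ge>1. r \<le> R k"
    and "aggregation_rule \<phi> Q N x P R y z"
    and "\<forall>k\<ge>1. z k = y k"
  shows "critical_point f x"
proof -
  note Q = \<open>transpose Q = Q\<close> and N = \<open>norm_function N\<close>
  note loop = \<open>inner_loop_infinite f \<phi> Q N \<gamma> \<gamma>' \<theta> M x P R y z\<close>[unfolded inner_loop_infinite_def]
  let ?h = "\<lambda>w. \<phi> w x"
  have h: "convex_on UNIV ?h" "\<phi> x x = f x" "convex_subdiff ?h x \<subseteq> clarke_subdiff f x"
    using \<open>strict_first_order_model f \<phi>\<close> unfolding strict_first_order_model_def by blast+
  obtain q where q: "0 < q" "\<And>v. q * (norm v)\<^sup>2 \<le> v \<bullet> (Q *v v)"
    using posdef_quadratic_lower_bound[OF \<open>\<forall>v. v \<noteq> 0 \<longrightarrow> 0 < v \<bullet> (Q *v v)\<close>] by blast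
  have psd: "0 \<le> v \<bullet> (Q *v v)" for v
    using q(1) by (intro order_trans[OF _ q(2)]) simp
  obtain r where r: "0 < r" "\<And>k. 1 \<le> k \<Longrightarrow> r \<le> R k"
    using assms(13) by blast

  \<comment> \<open>The counter of the loop starts at 1; shifted sequences are indexed from 0.\<close>
  define Y where "Y k = y (Suc k)" for k
  define W where "W k = P (Suc k)" for k
  define S where "S k = R (Suc k)" for k
  define a where "a k = second_order_working Q x (W k) (Y k)" for k
  have W: "working_planes \<phi> x (W k)"
    and argmin: "is_arg_min (second_order_working Q x (W k)) (\<lambda>w. w \<in> trust_region N x (S k)) (Y k)"
    and S_Suc: "S (Suc k)
      = (if secondary_ratio f Q x (W k) (W (Suc k)) (Y k) < \<gamma>' then S k else S k / 2)" for k
    using loop \<open>\<forall>k\<ge>1. z k = y k\<close> by (simp_all add: Y_def W_def S_def)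
  have agg: "\<exists>g. aggregate_subgradient Q N x (W k) (S k) (Y k) g
      \<and> aggregate_plane (W k) (Y k) g \<in> W (Suc k)"
    and cut: "\<exists>p\<in>W (Suc k). cutting_plane \<phi> x (Y k) p" for k
    using \<open>aggregation_rule \<phi> Q N x P R y z\<close> \<open>\<forall>k\<ge>1. z k = y k\<close>
    by (simp_all add: aggregation_rule_def Y_def W_def S_def)
  have fin: "finite (W k)" for k
    using W unfolding working_planes_def by blast
  have r_le: "r \<le> S k" for k
    using r(2) by (simp add: S_def)
  have S_mono: "S (Suc k) \<le> S k" for k
    using S_Suc[of k] r_le[of k] r(1) by simp
  have Y_in: "Y k \<in> trust_region N x (S k)" for k
    using argmin[of k] by (simp add: is_arg_min_def)
  have a_le: "a k \<le> second_order_working Q x (W k) w" if "w \<in> trust_region N x (S k)" for k w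
    using argmin[of k] that unfolding is_arg_min_def a_def by (meson not_le)
  have "N 0 = 0"
    using N by (simp add: norm_function_def)
  then have x_in: "x \<in> trust_region N x (S k)" for k
    using r_le[of k] r(1) by (simp add: trust_region_def)
  have model_x: "second_order_working Q x (W k) x = f x" for k
    using max_planes_exact_at_reference[OF W] h(2) by (simp add: second_order_working_def)
  have a_le_f: "a k \<le> f x" for k
    using a_le[OF x_in] model_x by simp

  have growth: "a k + q / 2 * (norm (Y (Suc k) - Y k))\<^sup>2 \<le> a (Suc k)" for k
  proof -
    obtain g where g: "aggregate_subgradient Q N x (W k) (S k) (Y k) g"
        "aggregate_plane (W k) (Y k) g \<in> W (Suc k)"
      using agg by blast
    have "Y (Suc k) \<in> trust_region N x (S k)"
      using Y_in[of "Suc k"] S_mono[of k] by (simp add: trust_region_def)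
    then show ?thesis
      using aggregate_quadratic_growth[OF Q g(1) _ plane_le_max_planes[OF fin g(2)]]
        q(2)[of "Y (Suc k) - Y k"] unfolding a_def by fastforce
  qed
  have steps: "(\<lambda>k. norm (Y (Suc k) - Y k)) \<longlonglongrightarrow> 0"
    using steps_vanish_if_sufficient_increase[of "q / 2" a Y, OF _ growth a_le_f] q(1) by simp

  \<comment> \<open>Boundedness of the iterates: quadratic growth of the current model from \<open>Y k\<close> to \<open>x\<close>,
    whose value there is \<open>f x\<close>, while the optimal values never fall below the first one.\<close>
  have "q / 2 * (norm (Y k - x))\<^sup>2 \<le> f x - a 0" for k
  proof -
    obtain g where g: "aggregate_subgradient Q N x (W k) (S k) (Y k) g"
      using agg by blast
    then have "aggregate_plane (W k) (Y k) g x \<le> max_planes (W k) x"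
      unfolding aggregate_subgradient_def convex_subdiff_def aggregate_plane_def by blast
    from aggregate_quadratic_growth[OF Q g x_in this]
    have "a k + q / 2 * (norm (x - Y k))\<^sup>2 \<le> f x"
      using q(2)[of "x - Y k"] by (simp add: a_def model_x)
    moreover have "a j \<le> a (Suc j)" for j
      using q(1) by (intro order_trans[OF _ growth]) simp
    then have "a 0 \<le> a k"
      using lift_Suc_mono_le[of a 0 k] by simp
    ultimately show ?thesis
      by (simp add: norm_minus_commute)
  qed
  then have Y_bdd: "Y k \<in> cball x (sqrt (2 * (f x - a 0) / q))" for k
    using q(1) by (auto simp: dist_norm norm_minus_commute field_simps intro!: real_le_rsqrt)
  obtain L where L: "0 < L" "\<And>k g. g \<in> convex_subdiff ?h (Y k) \<Longrightarrow> norm g \<le> L"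
    using convex_subdiff_bounded[OF h(1)] Y_bdd by metis

  define e where "e k = \<phi> (Y k) x - max_planes (W k) (Y k)" for k
  have "e (Suc k) \<le> 2 * L * norm (Y (Suc k) - Y k)" for k
  proof -
    obtain p where p: "p \<in> W (Suc k)" "cutting_plane \<phi> x (Y k) p"
      using cut by blast
    obtain g where "g \<in> convex_subdiff ?h (Y (Suc k))"
      using cut[of "Suc k"] unfolding cutting_plane_def by blast
    then show ?thesis
      unfolding e_def by (rule model_error_le_step[OF W p]) (use L in auto)
  qed
  then have "norm (e (Suc k)) \<le> 2 * L * norm (Y (Suc k) - Y k)" for k
    using max_planes_le_model[OF W, of "Suc k" "Y (Suc k)"] by (simp add: e_def)
  then have "(\<lambda>k. e (Suc k)) \<longlonglongrightarrow> 0"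
    by (intro Lim_null_comparison[OF always_eventually tendsto_mult_right_zero[OF steps]]) auto
  then have e_lim: "e \<longlonglongrightarrow> 0"
    by (rule LIMSEQ_imp_Suc)

  have "\<forall>\<^sub>F k in sequentially. secondary_ratio f Q x (W k) (W (Suc k)) (Y k) < \<gamma>'"
    by (rule finitely_many_halvings[where R = S, OF _ r(1) r_le]) (rule S_Suc)
  then have gap: "\<forall>\<^sub>F k in sequentially. f x - e k / (1 - \<gamma>') \<le> a k"
  proof eventually_elim
    case (elim k)
    have "max_planes (W (Suc k)) (Y k) = \<phi> (Y k) x"
      using cut[of k] cutting_plane_exact[OF W] by blast
    from optimal_value_gap_le_model_error[where \<phi> = \<phi>, OF elim this]
    have "(1 - \<gamma>') * (f x - a k) \<le> e k"
      using a_le_f[of k] max_planes_le_model[OF W] psd by (simp add: a_def e_def)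
    then show ?case
      using \<open>\<gamma>' < 1\<close> by (simp add: field_simps)
  qed
  have lim: "(\<lambda>k. f x - e k / (1 - \<gamma>')) \<longlonglongrightarrow> f x - 0 / (1 - \<gamma>')"
    using e_lim \<open>\<gamma>' < 1\<close> by (intro tendsto_intros) auto

  have "\<phi> x x \<le> \<phi> w x + 1/2 * ((w - x) \<bullet> (Q *v (w - x)))" if w: "w \<in> trust_region N x r" for w
  proof -
    have "a k \<le> \<phi> w x + 1/2 * ((w - x) \<bullet> (Q *v (w - x)))" for k
    proof -
      have "w \<in> trust_region N x (S k)"
        using w r_le[of k] by (simp add: trust_region_def)
      then show ?thesis
        using a_le max_planes_le_model[OF W, of k w]
        unfolding second_order_working_def by fastforce
    qed
    then have "\<forall>\<^sub>F k in sequentially.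
        f x - e k / (1 - \<gamma>') \<le> \<phi> w x + 1/2 * ((w - x) \<bullet> (Q *v (w - x)))"
      using gap by (auto elim!: eventually_mono intro: order_trans)
    then show ?thesis
      using tendsto_upperbound[OF lim] h(2) by simp
  qed
  from zero_subgradient_if_local_min_plus_quadratic[OF h(1) N r(1) this]
  have "0 \<in> convex_subdiff ?h x" .
  then show ?thesis
    using h(3) by (auto simp: critical_point_def)
qed

end
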